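(* Let $A\in\mathbb{R}^{r\times s}$, $\mathbf{v}\in\mathbb{R}^r$, $\mathbf{u}\in\mathbb{R}^s$, $\mathbf{x}\in\mathbb{R}^t$, $\mathbf{y}\in\mathbb{R}^w$ and $B\in\mathbb{R}^{w\times t}$, and suppose $$M=\begin{bmatrix}A & \mathbf{v}\\ \mathbf{u}^T & 0\end{bmatrix}\quad\text{and}\quad N=\begin{bmatrix}0 & \mathbf{x}^T\\ \mathbf{y} & B\end{bmatrix}$$ are row orthogonal ($MM^T=I$, $NN^T=I$), with $\mathbf{x},\mathbf{y},\mathbf{u},\mathbf{v}$ nowhere zero. Then $$Q=\begin{bmatrix}A & \mathbf{v}\mathbf{x}^T\\ \mathbf{y}\mathbf{u}^T & B\end{bmatrix}$$ is row orthogonal. Moreover, if both $M$ and $N$ have the strong inner product property, then $Q$ has the strong inner product property.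
   Context: All matrices are real; $\circ$ denotes the Hadamard product; a vector is nowhere zero if all its entries are nonzero. A matrix $P\in\mathbb{R}^{p\times q}$ with $p\le q$ has the strong inner product property (SIPP) if $P$ has rank $p$ and $X=O$ is the only symmetric $p\times p$ matrix $X$ with $(XP)\circ P=O$. *)

theory Defs
  imports Complex_Main "Jordan_Normal_Form.DL_Rank"
begin

definition hadamard_prod :: "real mat \<Rightarrow> real mat \<Rightarrow> real mat" (infixl \<open>\<circ>\<^sub>H\<close> 70) where
  "A \<circ>\<^sub>H B = mat (dim_row A) (dim_col A) (\<lambda>(i, j). A $$ (i, j) * B $$ (i, j))"

definition nowhere_zero :: "real vec \<Rightarrow> bool" where
  "nowhere_zero v \<longleftrightarrow> (\<forall>i < dim_vec v. v $ i \<noteq> 0)"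

definition row_orthogonal :: "real mat \<Rightarrow> bool" where
  "row_orthogonal P \<longleftrightarrow> P * transpose_mat P = 1\<^sub>m (dim_row P)"

definition SIPP :: "real mat \<Rightarrow> bool" where
  "SIPP P \<longleftrightarrow>
     dim_row P \<le> dim_col P \<and>
     vec_space.rank (dim_row P) P = dim_row P \<and>
     (\<forall>X \<in> carrier_mat (dim_row P) (dim_row P).
        transpose_mat X = X \<longrightarrow> (X * P) \<circ>\<^sub>H P = 0\<^sub>m (dim_row P) (dim_col P) \<longrightarrow>
        X = 0\<^sub>m (dim_row P) (dim_row P))"

abbreviation mat_of_col :: "real vec \<Rightarrow> real mat" where
  "mat_of_col v \<equiv> mat_of_cols (dim_vec v) [v]"

end

theory Submission
  imports Defs
begin

text \<open>
  Write a symmetric \<open>X\<close> with \<open>(X Q) \<circ> Q = O\<close> in blocks \<open>X\<^sub>1\<close>, \<open>Z\<close>, \<open>Z\<^sup>T\<close>, \<open>X\<^sub>2\<close>. The off-diagonal blocks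
  of \<open>Q\<close> are nowhere zero, so \<open>X\<^sub>1 v x\<^sup>T + Z B = O\<close> and \<open>Z\<^sup>T A + X\<^sub>2 y u\<^sup>T = O\<close>; since \<open>B x = 0\<close> and
  \<open>A u = 0\<close>, all four summands vanish. Then the symmetric matrix with blocks \<open>X\<^sub>1\<close>, \<open>Z y\<close>, \<open>(Z y)\<^sup>T\<close>, \<open>0\<close>
  annihilates \<open>M\<close> in the sense of the SIPP, and the one with blocks \<open>0\<close>, \<open>(Z\<^sup>T v)\<^sup>T\<close>, \<open>Z\<^sup>T v\<close>, \<open>X\<^sub>2\<close>
  annihilates \<open>N\<close>. Hence \<open>X\<^sub>1\<close>, \<open>X\<^sub>2\<close> and \<open>Z y\<close> vanish, and so does
  \<open>Z = Z (y y\<^sup>T + B B\<^sup>T)\<close>.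
\<close>

section \<open>Block matrices: equality, symmetry and row orthogonality\<close>

lemma four_block_mat_eq_iff:
  assumes "A \<in> carrier_mat n1 m1" "B \<in> carrier_mat n1 m2"
    "C \<in> carrier_mat n2 m1" "D \<in> carrier_mat n2 m2"
    "A' \<in> carrier_mat n1 m1" "B' \<in> carrier_mat n1 m2"
    "C' \<in> carrier_mat n2 m1" "D' \<in> carrier_mat n2 m2"
  shows "four_block_mat A B C D = four_block_mat A' B' C' D' \<longleftrightarrow>
    A = A' \<and> B = B' \<and> C = C' \<and> D = D'" (is "?F = ?F' \<longleftrightarrow> _")
proof (intro iffI)
  assume eq: "?F = ?F'"
  \<comment> \<open>Both sides share the block sizes, so a block entry sits at the same position on
    either side, shifted by \<open>n1\<close> rows or \<open>m1\<close> columns where the block is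
    not in the top left corner.\<close>
  have idx: "?F $$ (i, j) = ?F' $$ (i, j)" for i j
    by (simp only: eq)
  have "A = A'"
  proof (rule eq_matI)
    fix i j assume "i < dim_row A'" "j < dim_col A'"
    then show "A $$ (i, j) = A' $$ (i, j)"
      using idx[of i j] assms by simp
  qed (use assms in auto)
  moreover have "B = B'"
  proof (rule eq_matI)
    fix i j assume "i < dim_row B'" "j < dim_col B'"
    then show "B $$ (i, j) = B' $$ (i, j)"
      using idx[of i "j + m1"] assms by simp
  qed (use assms in auto)
  moreover have "C = C'"
  proof (rule eq_matI)
    fix i j assume "i < dim_row C'" "j < dim_col C'"
    then show "C $$ (i, j) = C' $$ (i, j)"
      using idx[of "i + n1" j] assms by simp
  qed (use assms in auto)
  moreover have "D = D'"
  proof (rule eq_matI)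
    fix i j assume "i < dim_row D'" "j < dim_col D'"
    then show "D $$ (i, j) = D' $$ (i, j)"
      using idx[of "i + n1" "j + m1"] assms by simp
  qed (use assms in auto)
  ultimately show "A = A' \<and> B = B' \<and> C = C' \<and> D = D'" by simp
qed simp

lemma symmetric_mat_four_blockE:
  assumes X: "X \<in> carrier_mat (n1 + n2) (n1 + n2)" and sym: "transpose_mat X = X"
  obtains X1 Z X2 where "X1 \<in> carrier_mat n1 n1" "Z \<in> carrier_mat n1 n2" "X2 \<in> carrier_mat n2 n2"
    "transpose_mat X1 = X1" "transpose_mat X2 = X2"
    "X = four_block_mat X1 Z (transpose_mat Z) X2"
proof -
  obtain X1 Z Z' X2 where split: "split_block X n1 n1 = (X1, Z, Z', X2)"
    by (metis prod_cases4)
  from X have dims: "dim_row X = n1 + n2" "dim_col X = n1 + n2" by auto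
  note c = split_block[OF split dims]
  \<comment> \<open>Transposing also swaps the off-diagonal blocks, so comparing with
    \<open>X\<close> identifies \<open>Z'\<close> as the transpose of \<open>Z\<close>.\<close>
  have "four_block_mat (transpose_mat X1) (transpose_mat Z') (transpose_mat Z) (transpose_mat X2)
      = four_block_mat X1 Z Z' X2"
    using sym c(5) transpose_four_block_mat[OF c(1-4)] by simp
  then have "transpose_mat X1 = X1 \<and> transpose_mat Z' = Z \<and> transpose_mat Z = Z' \<and> transpose_mat X2 = X2"
    using c(1-4) by (subst (asm) four_block_mat_eq_iff[of _ n1 n1 _ n2 _ n2]) auto
  with c that show thesis by metis
qed

lemma row_orthogonal_four_block_mat:
  assumes c: "A \<in> carrier_mat n1 m1" "B \<in> carrier_mat n1 m2"
    "C \<in> carrier_mat n2 m1" "D \<in> carrier_mat n2 m2"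
  shows "row_orthogonal (four_block_mat A B C D) \<longleftrightarrow>
    A * transpose_mat A + B * transpose_mat B = 1\<^sub>m n1 \<and>
    A * transpose_mat C + B * transpose_mat D = 0\<^sub>m n1 n2 \<and>
    C * transpose_mat A + D * transpose_mat B = 0\<^sub>m n2 n1 \<and>
    C * transpose_mat C + D * transpose_mat D = 1\<^sub>m n2"
proof -
  have ct: "transpose_mat A \<in> carrier_mat m1 n1" "transpose_mat C \<in> carrier_mat m1 n2"
    "transpose_mat B \<in> carrier_mat m2 n1" "transpose_mat D \<in> carrier_mat m2 n2"
    using c by auto
  have "1\<^sub>m (dim_row (four_block_mat A B C D)) =
      four_block_mat (1\<^sub>m n1) (0\<^sub>m n1 n2) (0\<^sub>m n2 n1) (1\<^sub>m n2 :: real mat)"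
    using c by simp
  then show ?thesis
    unfolding row_orthogonal_def transpose_four_block_mat[OF c] mult_four_block_mat[OF c ct]
    using c by (simp only:) (rule four_block_mat_eq_iff; auto)
qed

section \<open>Hadamard products of block matrices and of outer products\<close>

lemma hadamard_prod_carrier_mat [simp]:
  "A \<in> carrier_mat n m \<Longrightarrow> A \<circ>\<^sub>H B \<in> carrier_mat n m"
  by (auto simp: hadamard_prod_def)

lemma hadamard_prod_four_block_mat:
  assumes "A \<in> carrier_mat n1 m1" "B \<in> carrier_mat n1 m2"
    "C \<in> carrier_mat n2 m1" "D \<in> carrier_mat n2 m2"
    "A' \<in> carrier_mat n1 m1" "B' \<in> carrier_mat n1 m2"
    "C' \<in> carrier_mat n2 m1" "D' \<in> carrier_mat n2 m2"
  shows "four_block_mat A B C D \<circ>\<^sub>H four_block_mat A' B' C' D' =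
    four_block_mat (A \<circ>\<^sub>H A') (B \<circ>\<^sub>H B') (C \<circ>\<^sub>H C') (D \<circ>\<^sub>H D')"
  by (rule eq_matI) (use assms in \<open>auto simp: hadamard_prod_def\<close>)

text \<open>Serves to split the SIPP equation for \<open>M\<close>, \<open>N\<close> and
  \<open>Q\<close> alike, so that the equations for \<open>Q\<close> can be matched with those for
  \<open>M\<close> and \<open>N\<close>.\<close>

lemma hadamard_prod_mult_four_block_mat_eq_zero_iff:
  assumes X: "X1 \<in> carrier_mat n1 n1" "Z \<in> carrier_mat n1 n2"
      "Z' \<in> carrier_mat n2 n1" "X2 \<in> carrier_mat n2 n2"
    and P: "A \<in> carrier_mat n1 m1" "B \<in> carrier_mat n1 m2"
      "C \<in> carrier_mat n2 m1" "D \<in> carrier_mat n2 m2"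
  shows "(four_block_mat X1 Z Z' X2 * four_block_mat A B C D) \<circ>\<^sub>H four_block_mat A B C D
      = 0\<^sub>m (n1 + n2) (m1 + m2) \<longleftrightarrow>
    (X1 * A + Z * C) \<circ>\<^sub>H A = 0\<^sub>m n1 m1 \<and> (X1 * B + Z * D) \<circ>\<^sub>H B = 0\<^sub>m n1 m2 \<and>
    (Z' * A + X2 * C) \<circ>\<^sub>H C = 0\<^sub>m n2 m1 \<and> (Z' * B + X2 * D) \<circ>\<^sub>H D = 0\<^sub>m n2 m2"
proof -
  have "(four_block_mat X1 Z Z' X2 * four_block_mat A B C D) \<circ>\<^sub>H four_block_mat A B C D =
    four_block_mat ((X1 * A + Z * C) \<circ>\<^sub>H A) ((X1 * B + Z * D) \<circ>\<^sub>H B)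
      ((Z' * A + X2 * C) \<circ>\<^sub>H C) ((Z' * B + X2 * D) \<circ>\<^sub>H D)"
    unfolding mult_four_block_mat[OF X P]
    by (rule hadamard_prod_four_block_mat) (use X P in auto)
  moreover have "0\<^sub>m (n1 + n2) (m1 + m2) =
      four_block_mat (0\<^sub>m n1 m1) (0\<^sub>m n1 m2) (0\<^sub>m n2 m1) (0\<^sub>m n2 m2 :: real mat)"
    by simp
  ultimately show ?thesis
    by (simp only:)
      (rule four_block_mat_eq_iff[of _ n1 m1 _ m2 _ n2];
        (intro hadamard_prod_carrier_mat)?; use X P in simp)
qed

lemma hadamard_prod_zero_left [simp]: "0\<^sub>m n m \<circ>\<^sub>H A = 0\<^sub>m n m"
  by (rule eq_matI) (auto simp: hadamard_prod_def)

lemma hadamard_prod_zero_right [simp]: "A \<in> carrier_mat n m \<Longrightarrow> A \<circ>\<^sub>H 0\<^sub>m n m = 0\<^sub>m n m"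
  by (rule eq_matI) (auto simp: hadamard_prod_def)

text \<open>The outer product has the entries \<open>v $ i * x $ j\<close>, all nonzero, so the
  Hadamard factor cancels entrywise.\<close>

lemma hadamard_prod_outer_eq_zeroD:
  assumes "C \<in> carrier_mat (dim_vec v) (dim_vec x)" "nowhere_zero v" "nowhere_zero x"
    and "C \<circ>\<^sub>H (mat_of_col v * mat_of_row x) = 0\<^sub>m (dim_vec v) (dim_vec x)"
  shows "C = 0\<^sub>m (dim_vec v) (dim_vec x)"
proof (rule eq_matI)
  fix i j assume "i < dim_row (0\<^sub>m (dim_vec v) (dim_vec x) :: real mat)"
    "j < dim_col (0\<^sub>m (dim_vec v) (dim_vec x) :: real mat)"
  then have ij: "i < dim_vec v" "j < dim_vec x" by auto
  have "(mat_of_col v * mat_of_row x) $$ (i, j) = v $ i * x $ j"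
    using ij by (simp add: scalar_prod_def mat_of_cols_Cons_index_0)
  moreover have "(C \<circ>\<^sub>H (mat_of_col v * mat_of_row x)) $$ (i, j) = 0"
    using assms(4) ij by simp
  ultimately show "C $$ (i, j) = 0\<^sub>m (dim_vec v) (dim_vec x) $$ (i, j)"
    using ij assms by (auto simp: hadamard_prod_def nowhere_zero_def)
qed (use assms in auto)

text \<open>The transpose is a right inverse: every \<open>b\<close> is the image of
  \<open>transpose_mat P *\<^sub>v b\<close>, so the columns span the whole space.\<close>

lemma row_orthogonal_rank:
  assumes "row_orthogonal P"
  shows "vec_space.rank (dim_row P) P = dim_row P"
proof -
  let ?n = "dim_row P"
  interpret vec_space "TYPE(real)" ?n .
  have P: "P \<in> carrier_mat ?n (dim_col P)" by simp
  have PT: "transpose_mat P \<in> carrier_mat (dim_col P) ?n" by simp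
  have "P *\<^sub>v (transpose_mat P *\<^sub>v b) = b" if b: "b \<in> carrier_vec ?n" for b
    unfolding assoc_mult_mat_vec[OF P PT b, symmetric] assms[unfolded row_orthogonal_def]
    using b by (rule one_mult_mat_vec)
  moreover have "transpose_mat P *\<^sub>v b \<in> carrier_vec (dim_col P)" for b
    by (rule carrier_vecI) simp
  ultimately have "col_space P = carrier_vec ?n"
    unfolding col_space_eq[OF P] by blast
  then have "span_vs (set (cols P)) = V"
    by (simp add: col_space_def)
  then show ?thesis
    by (simp add: rank_def dim_is_n)
qed

lemma SIPP_imp_zero:
  assumes "SIPP P" "P \<in> carrier_mat n m" "X \<in> carrier_mat n n" "transpose_mat X = X"
    "(X * P) \<circ>\<^sub>H P = 0\<^sub>m n m"
  shows "X = 0\<^sub>m n n"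
  using assms by (auto simp: SIPP_def)

text \<open>Meant for the diagonal blocks of Q Q^T: as x and u are unit vectors, (v x^T)(x v^T) = v
  v^T and (y u^T)(u y^T) = y y^T.\<close>

lemma mult_mat_cancel_middle:
  fixes P H K W :: "'a :: semiring_1 mat"
  assumes c: "P \<in> carrier_mat a b" "H \<in> carrier_mat b d" "K \<in> carrier_mat d b"
      "W \<in> carrier_mat b e"
    and HK: "H * K = 1\<^sub>m b"
  shows "(P * H) * (K * W) = P * W"
proof -
  have "(P * H) * (K * W) = P * (H * (K * W))"
    using c by (intro assoc_mult_mat) auto
  also have "H * (K * W) = (H * K) * W"
    using c by (intro assoc_mult_mat[symmetric]) auto
  finally show ?thesis using c HK by simp
qed

theorem proposition5p11:
  fixes r s t w :: nat
    and A B M N Q :: "real mat"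
    and v u x y :: "real vec"
  assumes "A \<in> carrier_mat r s" and "v \<in> carrier_vec r" and "u \<in> carrier_vec s"
    and "x \<in> carrier_vec t" and "y \<in> carrier_vec w" and "B \<in> carrier_mat w t"
    and M_def: "M = four_block_mat A (mat_of_col v) (mat_of_row u) (0\<^sub>m 1 1)"
    and N_def: "N = four_block_mat (0\<^sub>m 1 1) (mat_of_row x) (mat_of_col y) B"
    and Q_def: "Q = four_block_mat A (mat_of_col v * mat_of_row x) (mat_of_col y * mat_of_row u) B"
    and "row_orthogonal M" and "row_orthogonal N"
    and "nowhere_zero x" and "nowhere_zero y" and "nowhere_zero u" and "nowhere_zero v"
  shows "row_orthogonal Q \<and> (SIPP M \<and> SIPP N \<longrightarrow> SIPP Q)"
proof -
  \<comment> \<open>Keeps the dimension \<open>1\<close> from turning into \<open>Suc 0\<close>, so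
    that the carrier facts below still match.\<close>
  note One_nat_def [simp del]
  define V U H Y where "V = mat_of_col v" and "U = mat_of_row u"
    and "H = mat_of_row x" and "Y = mat_of_col y"
  have A: "A \<in> carrier_mat r s" and B: "B \<in> carrier_mat w t"
    and V: "V \<in> carrier_mat r 1" and U: "U \<in> carrier_mat 1 s"
    and H: "H \<in> carrier_mat 1 t" and Y: "Y \<in> carrier_mat w 1"
    using assms by (auto simp: V_def U_def H_def Y_def)
  have VT: "transpose_mat V \<in> carrier_mat 1 r" and UT: "transpose_mat U \<in> carrier_mat s 1"
    and HT: "transpose_mat H \<in> carrier_mat t 1" and YT: "transpose_mat Y \<in> carrier_mat 1 w"
    and AT: "transpose_mat A \<in> carrier_mat s r" and BT: "transpose_mat B \<in> carrier_mat t w"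
    using A B V U H Y by auto
  have VH: "V * H \<in> carrier_mat r t" and YU: "Y * U \<in> carrier_mat w s"
    using V H Y U by auto
  have dims: "dim_vec v = r" "dim_vec u = s" "dim_vec x = t" "dim_vec y = w"
    using assms by auto
  have M: "M = four_block_mat A V U (0\<^sub>m 1 1)" and N: "N = four_block_mat (0\<^sub>m 1 1) H Y B"
    and Q: "Q = four_block_mat A (V * H) (Y * U) B"
    using M_def N_def Q_def by (simp_all add: V_def U_def H_def Y_def)
  have Mc: "M \<in> carrier_mat (r + 1) (s + 1)" and Nc: "N \<in> carrier_mat (1 + w) (1 + t)"
    and Qc: "Q \<in> carrier_mat (r + w) (s + t)"
    unfolding M N Q using A B by (intro four_block_carrier_mat; simp)+
  have z11: "0\<^sub>m 1 1 \<in> carrier_mat 1 (1::nat)" by simp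
  \<comment> \<open>The zero corner of \<open>M\<close> removes the contribution of \<open>V\<close>
    from every block of M M^T but the first; the zero corner of \<open>N\<close> acts likewise
    below.\<close>
  have AV: "A * transpose_mat A + V * transpose_mat V = 1\<^sub>m r"
    and AU: "A * transpose_mat U = 0\<^sub>m r 1" and UA: "U * transpose_mat A = 0\<^sub>m 1 r"
    and UU: "U * transpose_mat U = 1\<^sub>m 1"
    using \<open>row_orthogonal M\<close> A V U VT UT AT
    unfolding M row_orthogonal_four_block_mat[OF A V U z11]
    by (simp_all add: right_mult_zero_mat[OF V] left_mult_zero_mat[OF VT])
  have HH: "H * transpose_mat H = 1\<^sub>m 1" and HB: "H * transpose_mat B = 0\<^sub>m 1 w"
    and BH: "B * transpose_mat H = 0\<^sub>m w 1"
    and YB: "Y * transpose_mat Y + B * transpose_mat B = 1\<^sub>m w"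
    using \<open>row_orthogonal N\<close> B H Y HT YT BT
    unfolding N row_orthogonal_four_block_mat[OF z11 H Y B]
    by (simp_all add: right_mult_zero_mat[OF Y] left_mult_zero_mat[OF YT])

  \<comment> \<open>Row orthogonality of \<open>Q\<close>\<close>
  have orth: "row_orthogonal Q"
    unfolding Q row_orthogonal_four_block_mat[OF A VH YU B]
      transpose_mult[OF V H] transpose_mult[OF Y U]
      mult_mat_cancel_middle[OF V H HT VT HH] mult_mat_cancel_middle[OF Y U UT YT UU]
      assoc_mult_mat[OF A UT YT, symmetric] assoc_mult_mat[OF V H BT]
      assoc_mult_mat[OF Y U AT] assoc_mult_mat[OF B HT VT, symmetric]
      AU UA HB BH
    using AV YB by (simp add: left_mult_zero_mat[OF VT] left_mult_zero_mat[OF YT]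
      right_mult_zero_mat[OF V] right_mult_zero_mat[OF Y])

  \<comment> \<open>The strong inner product property of \<open>Q\<close>\<close>
  have "SIPP Q" if SM: "SIPP M" and SN: "SIPP N"
    unfolding SIPP_def
  proof (intro conjI ballI impI)
    \<comment> \<open>Add r + 1 \<le> s + 1 and 1 + w \<le> 1 + t.\<close>
    show "dim_row Q \<le> dim_col Q"
      using SM SN Mc Nc Qc by (simp add: SIPP_def)
    show "vec_space.rank (dim_row Q) Q = dim_row Q"
      using orth by (rule row_orthogonal_rank)
  next
    fix X assume "X \<in> carrier_mat (dim_row Q) (dim_row Q)" and sym: "transpose_mat X = X"
      and zero: "(X * Q) \<circ>\<^sub>H Q = 0\<^sub>m (dim_row Q) (dim_col Q)"
    then have "X \<in> carrier_mat (r + w) (r + w)" using Qc by simp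
    then obtain X1 Z X2 where X1: "X1 \<in> carrier_mat r r" and Z: "Z \<in> carrier_mat r w"
      and X2: "X2 \<in> carrier_mat w w"
      and sym1: "transpose_mat X1 = X1" and sym2: "transpose_mat X2 = X2"
      and X: "X = four_block_mat X1 Z (transpose_mat Z) X2"
      using sym by (rule symmetric_mat_four_blockE)
    have ZT: "transpose_mat Z \<in> carrier_mat w r" using Z by simp
    have ZY: "Z * Y \<in> carrier_mat r 1" and ZV: "transpose_mat Z * V \<in> carrier_mat w 1"
      using Z ZT Y V by auto
    have "(X * Q) \<circ>\<^sub>H Q = 0\<^sub>m (r + w) (s + t)" using zero Qc by simp
    then have c1: "(X1 * A + Z * (Y * U)) \<circ>\<^sub>H A = 0\<^sub>m r s"
      and c2: "(X1 * (V * H) + Z * B) \<circ>\<^sub>H (V * H) = 0\<^sub>m r t"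
      and c3: "(transpose_mat Z * A + X2 * (Y * U)) \<circ>\<^sub>H (Y * U) = 0\<^sub>m w s"
      and c4: "(transpose_mat Z * (V * H) + X2 * B) \<circ>\<^sub>H B = 0\<^sub>m w t"
      unfolding X Q hadamard_prod_mult_four_block_mat_eq_zero_iff[OF X1 Z ZT X2 A VH YU B]
      by auto
    have e2: "X1 * (V * H) + Z * B = 0\<^sub>m r t"
      using hadamard_prod_outer_eq_zeroD[of "X1 * (V * H) + Z * B" v x] c2 X1 VH Z B assms dims
      by (simp add: V_def H_def)
    have e3: "transpose_mat Z * A + X2 * (Y * U) = 0\<^sub>m w s"
      using hadamard_prod_outer_eq_zeroD[of "transpose_mat Z * A + X2 * (Y * U)" y u]
        c3 X2 YU ZT A assms dims
      by (simp add: Y_def U_def)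
    \<comment> \<open>Multiplying \<open>e2\<close> on the right by the transpose of
      \<open>H\<close> kills the summand with \<open>B\<close> by \<open>BH\<close> and strips
      \<open>H\<close> from the other by \<open>HH\<close>.\<close>
    have X1V: "X1 * V = 0\<^sub>m r 1"
    proof -
      have "0\<^sub>m r 1 = (X1 * (V * H) + Z * B) * transpose_mat H"
        unfolding e2 by (rule left_mult_zero_mat[OF HT, symmetric])
      also have "\<dots> = X1 * (V * H) * transpose_mat H + Z * B * transpose_mat H"
        by (rule add_mult_distrib_mat[OF mult_carrier_mat[OF X1 VH] mult_carrier_mat[OF Z B] HT])
      also have "X1 * (V * H) * transpose_mat H = X1 * V"
        unfolding assoc_mult_mat[OF X1 VH HT] assoc_mult_mat[OF V H HT] HH
        using V by simp
      also have "Z * B * transpose_mat H = 0\<^sub>m r 1"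
        unfolding assoc_mult_mat[OF Z B HT] BH by (rule right_mult_zero_mat[OF Z])
      finally show ?thesis using X1 V by simp
    qed
    have ZB: "Z * B = 0\<^sub>m r t"
      using e2 Z B
      unfolding assoc_mult_mat[OF X1 V H, symmetric] X1V left_mult_zero_mat[OF H] by simp
    \<comment> \<open>The mirror argument: \<open>e3\<close> times the transpose of
      \<open>U\<close>, with \<open>AU\<close> and \<open>UU\<close>.\<close>
    have X2Y: "X2 * Y = 0\<^sub>m w 1"
    proof -
      have "0\<^sub>m w 1 = (transpose_mat Z * A + X2 * (Y * U)) * transpose_mat U"
        unfolding e3 by (rule left_mult_zero_mat[OF UT, symmetric])
      also have "\<dots> = transpose_mat Z * A * transpose_mat U + X2 * (Y * U) * transpose_mat U"
        by (rule add_mult_distrib_mat[OF mult_carrier_mat[OF ZT A] mult_carrier_mat[OF X2 YU] UT])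
      also have "X2 * (Y * U) * transpose_mat U = X2 * Y"
        unfolding assoc_mult_mat[OF X2 YU UT] assoc_mult_mat[OF Y U UT] UU
        using Y by simp
      also have "transpose_mat Z * A * transpose_mat U = 0\<^sub>m w 1"
        unfolding assoc_mult_mat[OF ZT A UT] AU by (rule right_mult_zero_mat[OF ZT])
      finally show ?thesis using X2 Y by simp
    qed
    have ZA: "transpose_mat Z * A = 0\<^sub>m w s"
      using e3 ZT A
      unfolding assoc_mult_mat[OF X2 Y U, symmetric] X2Y left_mult_zero_mat[OF U] by simp
    \<comment> \<open>The block \<open>Z * Y\<close> is chosen because Z (Y U) = (Z Y) U turns
      \<open>c1\<close> into the condition at \<open>A\<close>. The conditions at \<open>V\<close>
      and \<open>U\<close> follow from \<open>X1V\<close> and \<open>ZA\<close>, and the one at the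
      corner is trivial since the corner of \<open>M\<close> is zero.\<close>
    have "four_block_mat X1 (Z * Y) (transpose_mat (Z * Y)) (0\<^sub>m 1 1) = 0\<^sub>m (r + 1) (r + 1)"
    proof (rule SIPP_imp_zero[OF SM Mc])
      have ZYT: "transpose_mat (Z * Y) \<in> carrier_mat 1 r" using ZY by simp
      have "transpose_mat (Z * Y) * A = 0\<^sub>m 1 s"
        using assoc_mult_mat[OF YT ZT A] ZA YT by (simp add: transpose_mult[OF Z Y])
      then show "(four_block_mat X1 (Z * Y) (transpose_mat (Z * Y)) (0\<^sub>m 1 1) * M) \<circ>\<^sub>H M
          = 0\<^sub>m (r + 1) (s + 1)"
        unfolding M hadamard_prod_mult_four_block_mat_eq_zero_iff[OF X1 ZY ZYT z11 A V U z11]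
        using c1 X1V assoc_mult_mat[OF Z Y U] ZY ZYT U V
        by (simp add: right_mult_zero_mat[OF ZY])
    qed (use X1 ZY sym1 in \<open>simp_all add: transpose_four_block_mat[OF X1 ZY _ z11]\<close>)
    then have X1_0: "X1 = 0\<^sub>m r r" and ZY_0: "Z * Y = 0\<^sub>m r 1"
      using four_block_mat_eq_iff[of X1 r r "Z * Y" 1 "transpose_mat (Z * Y)" 1 "0\<^sub>m 1 1"
        "0\<^sub>m r r" "0\<^sub>m r 1" "0\<^sub>m 1 r" "0\<^sub>m 1 1"] X1 ZY by auto
    \<comment> \<open>Here Z^T (V H) = (Z^T V) H turns \<open>c4\<close> into the condition at
      \<open>B\<close>, while \<open>ZB\<close> and \<open>X2Y\<close> settle those at
      \<open>H\<close> and \<open>Y\<close>.\<close>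
    have "four_block_mat (0\<^sub>m 1 1) (transpose_mat (transpose_mat Z * V)) (transpose_mat Z * V) X2
        = 0\<^sub>m (1 + w) (1 + w)"
    proof (rule SIPP_imp_zero[OF SN Nc])
      have ZVT: "transpose_mat (transpose_mat Z * V) \<in> carrier_mat 1 w" using ZV by simp
      have "transpose_mat (transpose_mat Z * V) * B = 0\<^sub>m 1 t"
        using assoc_mult_mat[OF VT Z B] ZB VT by (simp add: transpose_mult[OF ZT V])
      then show "(four_block_mat (0\<^sub>m 1 1) (transpose_mat (transpose_mat Z * V))
          (transpose_mat Z * V) X2 * N) \<circ>\<^sub>H N = 0\<^sub>m (1 + w) (1 + t)"
        unfolding N hadamard_prod_mult_four_block_mat_eq_zero_iff[OF z11 ZVT ZV X2 z11 H Y B]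
        using c4 X2Y assoc_mult_mat[OF ZT V H] ZV ZVT H Y
        by (simp add: right_mult_zero_mat[OF ZV])
    qed (use X2 ZV sym2 in \<open>simp_all add: transpose_four_block_mat[OF z11 _ ZV X2]\<close>)
    then have X2_0: "X2 = 0\<^sub>m w w"
      using four_block_mat_eq_iff[of "0\<^sub>m 1 1" 1 1 "transpose_mat (transpose_mat Z * V)" w
        "transpose_mat Z * V" w X2 "0\<^sub>m 1 1" "0\<^sub>m 1 w" "0\<^sub>m w 1" "0\<^sub>m w w"] X2 ZV by auto
    have "Z = Z * (Y * transpose_mat Y + B * transpose_mat B)"
      unfolding YB using Z by simp
    also have "\<dots> = Z * Y * transpose_mat Y + Z * B * transpose_mat B"
      unfolding assoc_mult_mat[OF Z Y YT] assoc_mult_mat[OF Z B BT]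
      by (rule mult_add_distrib_mat[OF Z mult_carrier_mat[OF Y YT] mult_carrier_mat[OF B BT]])
    also have "\<dots> = 0\<^sub>m r w"
      unfolding ZY_0 ZB using YT BT by simp
    finally have "Z = 0\<^sub>m r w" .
    with X1_0 X2_0 show "X = 0\<^sub>m (dim_row Q) (dim_row Q)"
      unfolding X using Qc by simp
  qed
  with orth show ?thesis by simp
qed

end
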